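(* Let $p$ be a prime and let $G$ be a finite non-abelian $p$-group. Let $L(G)$ be the absolute centre of $G$ and let $p^n=\exp(L(G))$. Then $\mathrm{Aut}_l(G)=\mathrm{Inn}(G)$ if and only if the following three conditions all hold: $G'\leq L(G)$, $L(G)$ is cyclic, and $Z(G)=L(G)G^{p^n}$.
   Context: For a finite group $G$: $Z(G)$ is the centre, $G'$ the commutator (derived) subgroup, $\mathrm{Aut}(G)$ the automorphism group, $\mathrm{Inn}(G)$ the group of inner automorphisms, and $\exp(\cdot)$ denotes the exponent. The absolute centre of $G$ is $L(G)=\{g\in G : \alpha(g)=g \text{ for all } \alpha\in\mathrm{Aut}(G)\}$; it is a characteristic subgroup of $G$ contained in $Z(G)$. An automorphism $\alpha$ of $G$ is absolute central if $g^{-1}\alpha(g)\in L(G)$ for every $g\in G$; $\mathrm{Aut}_l(G)$ denotes the group of all absolute central automorphisms of $G$. For an integer $n\ge 0$, $G^{p^n}$ denotes the subgroup of $G$ generated by all $p^n$-th powers of elements of $G$. *)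

theory Defs
  imports "HOL-Computational_Algebra.Primes" "HOL-Algebra.Algebra"
begin

definition centre :: "('a, 'b) monoid_scheme \<Rightarrow> 'a set" where
  "centre G = {z \<in> carrier G. \<forall>g \<in> carrier G. z \<otimes>\<^bsub>G\<^esub> g = g \<otimes>\<^bsub>G\<^esub> z}"

text \<open>Automorphisms are the elements of \<^term>\<open>auto G\<close>, which are extensional functions
  (\<^term>\<open>undefined\<close> outside the carrier); the restriction below makes an inner automorphism
  an element of that set, so that sets of automorphisms can be compared by equality.\<close>

definition inner_auto :: "('a, 'b) monoid_scheme \<Rightarrow> ('a \<Rightarrow> 'a) set" where
  "inner_auto G =
     (\<lambda>g. \<lambda>x \<in> carrier G. g \<otimes>\<^bsub>G\<^esub> x \<otimes>\<^bsub>G\<^esub> inv\<^bsub>G\<^esub> g) ` carrier G"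

definition absolute_centre :: "('a, 'b) monoid_scheme \<Rightarrow> 'a set" where
  "absolute_centre G = {g \<in> carrier G. \<forall>\<alpha> \<in> auto G. \<alpha> g = g}"

definition absolute_central_auto :: "('a, 'b) monoid_scheme \<Rightarrow> ('a \<Rightarrow> 'a) set" where
  "absolute_central_auto G =
     {\<alpha> \<in> auto G. \<forall>g \<in> carrier G. inv\<^bsub>G\<^esub> g \<otimes>\<^bsub>G\<^esub> \<alpha> g \<in> absolute_centre G}"

text \<open>The \<open>LEAST\<close> below is unspecified for a group of infinite exponent; in a finite group
  a suitable \<open>m\<close> always exists.\<close>

definition group_exponent :: "('a, 'b) monoid_scheme \<Rightarrow> nat" where
  "group_exponent G = (LEAST m. 0 < m \<and> (\<forall>x \<in> carrier G. x [^]\<^bsub>G\<^esub> m = \<one>\<^bsub>G\<^esub>))"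

definition power_subgroup :: "('a, 'b) monoid_scheme \<Rightarrow> nat \<Rightarrow> 'a set" where
  "power_subgroup G m = generate G ((\<lambda>x. x [^]\<^bsub>G\<^esub> m) ` carrier G)"

definition finite_p_group :: "nat \<Rightarrow> ('a, 'b) monoid_scheme \<Rightarrow> bool" where
  "finite_p_group p G \<longleftrightarrow> group G \<and> finite (carrier G) \<and> (\<exists>k. order G = p ^ k)"

lemma absolute_centre_fixed:
  "\<lbrakk>a \<in> absolute_centre G; \<alpha> \<in> auto G\<rbrakk> \<Longrightarrow> \<alpha> a = a"
  by (simp add: absolute_centre_def)

lemma (in group) subgroup_absolute_centre: "subgroup (absolute_centre G) G"
proof (rule subgroupI)
  show carr: "absolute_centre G \<subseteq> carrier G"
    by (auto simp: absolute_centre_def)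
  have hom: "group_hom G G \<alpha>" if "\<alpha> \<in> auto G" for \<alpha>
    using that by (simp add: auto_def group_hom_def group_hom_axioms_def)
  have "\<one> \<in> absolute_centre G"
    by (simp add: absolute_centre_def group_hom.hom_one[OF hom])
  then show "absolute_centre G \<noteq> {}"
    by blast
  fix a b
  assume a: "a \<in> absolute_centre G"
  have "\<alpha> (inv a) = inv a" if \<alpha>: "\<alpha> \<in> auto G" for \<alpha>
    using group_hom.hom_inv[OF hom[OF \<alpha>], of a] absolute_centre_fixed[OF a \<alpha>] a carr by auto
  with a carr show "inv a \<in> absolute_centre G"
    by (auto simp: absolute_centre_def)
  assume b: "b \<in> absolute_centre G"
  have "\<alpha> (a \<otimes> b) = a \<otimes> b" if \<alpha>: "\<alpha> \<in> auto G" for \<alpha>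
    using group_hom.hom_mult[OF hom[OF \<alpha>], of a b]
      absolute_centre_fixed[OF a \<alpha>] absolute_centre_fixed[OF b \<alpha>] a b carr by auto
  with a b carr show "a \<otimes> b \<in> absolute_centre G"
    by (auto simp: absolute_centre_def)
qed

end

theory Submission
  imports Defs
begin

text \<open>
  Write \<open>L = L(G)\<close>, \<open>Z = Z(G)\<close> and \<open>N = p^n = exp(L)\<close>. Inner automorphisms fix \<open>L\<close>, so \<open>L \<subseteq> Z\<close>. An
  absolute central automorphism \<open>\<alpha>\<close> is determined by its displacement \<open>x \<mapsto> x^-1 \<alpha>(x)\<close>, which is a
  homomorphism \<open>G \<rightarrow> L\<close> killing \<open>L\<close>, and every such homomorphism arises
  (\<open>displacement_hom\<close>, \<open>absolute_central_auto_of_hom\<close>). The displacements of the inner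
  automorphisms are the commutator maps \<open>x \<mapsto> x^-1 g x g^-1\<close>; they have values in \<open>L\<close> exactly when \<open>G' \<subseteq> L\<close>.
  So the theorem asks when every element of \<open>Hom(G/L, L)\<close> is a commutator map.

  If \<open>G' \<subseteq> L\<close>, \<open>L\<close> is cyclic and \<open>Z = L G^N\<close>, then every element of \<open>Hom(G/L, L)\<close> kills
  \<open>L G^N = Z\<close>. A finite group has at most \<open>|G/Z|\<close> homomorphisms into a cyclic group that kill \<open>Z\<close>
  (\<open>card_homs_to_cyclic_le\<close>), and there are \<open>|G/Z|\<close> inner automorphisms, so these are all.

  Conversely, suppose that all these homomorphisms are commutator maps; in particular they kill
  \<open>Z\<close>. Homomorphisms into a cyclic subgroup of \<open>L\<close> of order \<open>N\<close> separate the points of each abelian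
  quotient of \<open>G\<close> of exponent dividing \<open>N\<close> (\<open>homs_to_cyclic_separate\<close>). Applied to \<open>G/(L G^N)\<close> this
  shows that nothing in \<open>Z\<close> lies outside \<open>L G^N\<close>. That \<open>L\<close> is cyclic
  follows from the skew-symmetry of the commutator pairing: two independent elements of order \<open>p\<close> in \<open>L\<close>
  give two independent commutator maps that factor through the same cyclic quotient of \<open>G\<close>, and a
  homomorphism with cyclic image that kills \<open>Z\<close> but not the element defining one of these maps, being
  itself a commutator map, would place both elements into one cyclic group
  (\<open>cyclic_absolute_centre_if_eq_inner\<close>).
\<close>

section \<open>Roots in finite groups and cyclicity\<close>

lemma card_le_fibre_bound:
  assumes "finite A" and "\<And>y. y \<in> f ` A \<Longrightarrow> card {x \<in> A. f x = y} \<le> m"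
  shows "card A \<le> m * card (f ` A)"
proof -
  have "card A = (\<Sum>y \<in> f ` A. card {x \<in> A. f x = y})"
    using sum.image_gen[OF assms(1), of "\<lambda>_. 1::nat" f] by simp
  also have "\<dots> \<le> of_nat (card (f ` A)) * m"
    by (rule sum_bounded_above) (use assms(2) in auto)
  finally show ?thesis by (simp add: mult.commute)
qed

text \<open>The solutions of \<open>y^m = t\<close> form a coset of the solutions of \<open>y^m = 1\<close> as soon as there is
  one: dividing by a fixed solution maps the former injectively into the latter.\<close>

lemma (in group) card_power_fibre_le:
  fixes m :: nat
  assumes A: "subgroup A G" "finite A"
    and comm: "\<And>x y. x \<in> A \<Longrightarrow> y \<in> A \<Longrightarrow> x \<otimes> y = y \<otimes> x"
  shows "card {y \<in> A. y [^] m = t} \<le> card {y \<in> A. y [^] m = \<one>}"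
proof (cases "{y \<in> A. y [^] m = t} = {}")
  case False
  then obtain y0 where y0: "y0 \<in> A" "y0 [^] m = t" by auto
  have car: "\<And>y. y \<in> A \<Longrightarrow> y \<in> carrier G"
    using A(1) subgroup.mem_carrier by metis
  have "(inv y0 \<otimes> y) [^] m = \<one>" if "y \<in> A" "y [^] m = t" for y
  proof -
    have "(inv y0 \<otimes> y) [^] m = inv y0 [^] m \<otimes> y [^] m"
      using that y0 car A by (intro pow_mult_distrib comm) (auto simp: subgroup.m_inv_closed)
    then show ?thesis using that y0 car nat_pow_closed[OF car[OF y0(1)], of m] by (simp add: nat_pow_inv)
  qed
  then have "(\<lambda>y. inv y0 \<otimes> y) ` {y \<in> A. y [^] m = t} \<subseteq> {y \<in> A. y [^] m = \<one>}"
    using y0 A(1) by (auto simp: subgroup.m_closed subgroup.m_inv_closed)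
  moreover have "inj_on (\<lambda>y. inv y0 \<otimes> y) {y \<in> A. y [^] m = t}"
    using y0 car by (auto simp: inj_on_def)
  ultimately show ?thesis
    using A(2) by (intro card_inj_on_le) auto
next
  case True
  then show ?thesis by (metis card.empty le0)
qed

lemma (in group) generate_singleton_nat:
  assumes "finite (carrier G)" "c \<in> carrier G"
  shows "generate G {c} = range (\<lambda>i::nat. c [^] i)"
  using generate_pow_on_finite_carrier[OF assms] by auto

text \<open>With \<open>d = gcd(m, ord c)\<close>, the condition \<open>c^(i m) = 1\<close> says that \<open>ord c / d\<close> divides \<open>i\<close>, so the
  \<open>m\<close>-th roots of unity in \<open>\<langle>c\<rangle>\<close> are the powers of the single element \<open>c^(ord c / d)\<close> of order
  \<open>d \<le> m\<close>.\<close>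

lemma (in group) card_roots_cyclic_le:
  fixes m :: nat
  assumes fin: "finite (carrier G)" and c: "c \<in> carrier G" and m: "m > 0"
  shows "card {y \<in> generate G {c}. y [^] m = t} \<le> m"
proof -
  have gen: "generate G {c} = range (\<lambda>i::nat. c [^] i)"
    by (rule generate_singleton_nat[OF fin c])
  have sub: "subgroup (generate G {c}) G" using c by (simp add: generate_is_subgroup)
  have finC: "finite (generate G {c})"
    using fin finite_subset subgroup.subset[OF sub] by blast
  define d where "d = gcd m (ord c)"
  have oc: "ord c \<ge> 1" by (rule ord_ge_1[OF fin c])
  have d: "d > 0" "d \<le> m" "d dvd ord c" "d dvd m" using m by (auto simp: d_def)
  define w where "w = c [^] (ord c div d)"
  have w: "w \<in> carrier G" "w [^] d = \<one>"
    using c d by (auto simp: w_def nat_pow_pow)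
  have "{y \<in> generate G {c}. y [^] m = \<one>} \<subseteq> (\<lambda>j. w [^] j) ` {..<d}"
  proof clarify
    fix y assume "y \<in> generate G {c}" "y [^] m = \<one>"
    then obtain i :: nat where i: "y = c [^] i" "ord c dvd i * m"
      using c by (auto simp: gen nat_pow_pow pow_eq_id)
    have "ord c div d dvd i * (m div d)"
    proof -
      have "d * (ord c div d) dvd d * (i * (m div d))"
        using i(2) d by (simp add: mult.left_commute[of d i])
      then show ?thesis using d(1) by simp
    qed
    moreover have "coprime (ord c div d) (m div d)"
      using div_gcd_coprime[of m "ord c"] m by (simp add: d_def coprime_commute)
    ultimately have "ord c div d dvd i" by (simp add: coprime_dvd_mult_left_iff)
    then obtain q where q: "i = ord c div d * q" by blast
    have "y = w [^] q" using c by (simp add: i q w_def nat_pow_pow)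
    also have "\<dots> = w [^] (d * (q div d) + q mod d)" by simp
    also have "\<dots> = (w [^] d) [^] (q div d) \<otimes> w [^] (q mod d)"
      using w(1) by (simp only: nat_pow_mult nat_pow_pow)
    finally have "y = w [^] (q mod d)" using w by simp
    then show "y \<in> (\<lambda>j. w [^] j) ` {..<d}" using d by auto
  qed
  then have "card {y \<in> generate G {c}. y [^] m = \<one>} \<le> d"
    using surj_card_le[OF finite_lessThan, of _ "\<lambda>j. w [^] j" d] by simp
  moreover have "card {y \<in> generate G {c}. y [^] m = t} \<le> card {y \<in> generate G {c}. y [^] m = \<one>}"
  proof (rule card_power_fibre_le[OF sub finC])
    fix x y assume "x \<in> generate G {c}" "y \<in> generate G {c}"
    then obtain i j :: nat where "x = c [^] i" "y = c [^] j" unfolding gen by blast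
    then show "x \<otimes> y = y \<otimes> x" using c by (simp add: nat_pow_mult add.commute)
  qed
  ultimately show ?thesis using d by linarith
qed

text \<open>A fibre of \<open>x \<mapsto> x^p\<close> has at most \<open>p\<close> elements, so by iteration at most \<open>p^k\<close> elements satisfy
  \<open>x^(p^k) = 1\<close>. In a group of order \<open>p^e\<close> with \<open>e > 0\<close> the case \<open>k = e - 1\<close> leaves over an
  element, whose order can only be \<open>p^e\<close>.\<close>

lemma (in comm_group) p_group_cyclic_if_few_roots:
  assumes p: "Factorial_Ring.prime p" and ord: "order G = p ^ e"
    and few: "card {x \<in> carrier G. x [^] p = \<one>} \<le> p"
  obtains x where "x \<in> carrier G" "generate G {x} = carrier G"
proof -
  have p1: "p > 1" by (rule prime_gt_1_nat[OF p])
  have fin: "finite (carrier G)"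
    using ord p1 order_gt_0_iff_finite by simp
  define S where "S k = {x \<in> carrier G. x [^] (p ^ k) = \<one>}" for k
  have finS: "finite (S k)" for k using fin by (simp add: S_def)
  have card_S: "card (S k) \<le> p ^ k" for k
  proof (induction k)
    case 0
    have "S 0 = {\<one>}" by (auto simp: S_def)
    then show ?case by simp
  next
    case (Suc k)
    have "card (S (Suc k)) \<le> p * card ((\<lambda>x. x [^] p) ` S (Suc k))"
    proof (rule card_le_fibre_bound[OF finS])
      fix y
      have "card {x \<in> S (Suc k). x [^] p = y} \<le> card {x \<in> carrier G. x [^] p = y}"
        by (rule card_mono) (use fin in \<open>auto simp: S_def\<close>)
      also have "\<dots> \<le> card {x \<in> carrier G. x [^] p = \<one>}"
        by (rule card_power_fibre_le[OF subgroup_self fin]) (simp add: m_comm)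
      finally show "card {x \<in> S (Suc k). x [^] p = y} \<le> p" using few by simp
    qed
    also have "(\<lambda>x. x [^] p) ` S (Suc k) \<subseteq> S k" by (auto simp: S_def nat_pow_pow)
    then have "card ((\<lambda>x. x [^] p) ` S (Suc k)) \<le> p ^ k"
      using Suc card_mono[OF finS] le_trans by blast
    finally show ?case by simp
  qed
  show ?thesis
  proof (cases e)
    case 0
    then have "carrier G = {\<one>}" using ord order_one_triv_iff by simp
    then have "generate G {\<one>} = carrier G"
      using generate.one generate_incl[of "{\<one>}"] by auto
    then show ?thesis using that by blast
  next
    case (Suc k)
    have "card (S k) < card (carrier G)"
      using card_S[of k] ord p1 by (simp add: order_def Suc le_less_trans)
    then obtain x where x: "x \<in> carrier G" "x \<notin> S k"
      using finS card_mono[of "S k" "carrier G"] by (auto simp: not_le)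
    have "ord x dvd p ^ Suc k" using ord_dvd_group_order[OF x(1)] ord Suc by simp
    then obtain j where j: "j \<le> Suc k" "ord x = p ^ j"
      using p divides_primepow_nat by blast
    have "\<not> j \<le> k"
      using x j by (auto simp: S_def pow_eq_id le_imp_power_dvd)
    then have "card (generate G {x}) = card (carrier G)"
      using j ord Suc generate_pow_card[OF x(1)] by (simp add: order_def le_Suc_eq)
    then have "generate G {x} = carrier G"
      using fin x by (intro card_subset_eq) (auto intro!: generate_incl)
    then show ?thesis using that x by blast
  qed
qed

section \<open>Counting homomorphisms into a cyclic group\<close>

text \<open>This is the bound \<open>|Hom(G/K, C)| \<le> |G/K|\<close> for cyclic \<open>C = \<langle>c\<rangle>\<close>. It is proved for the
  restrictions of the homomorphisms to subgroups \<open>H \<supseteq> K\<close>, by enlarging \<open>H\<close>: if \<open>m\<close> is the least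
  positive exponent with \<open>x^m \<in> H\<close>, then adjoining \<open>x\<close> multiplies the order of \<open>H\<close> by at least \<open>m\<close>,
  while a homomorphism \<open>f\<close> given on \<open>H\<close> extends in at most \<open>m\<close> ways, since \<open>f(x)\<close> is one of the
  solutions in \<open>C\<close> of \<open>y^m = f(x^m)\<close>.\<close>

lemma (in group) card_homs_to_cyclic_le:
  assumes fin: "finite (carrier G)" and c: "c \<in> carrier G"
    and K: "subgroup K G"
    and F: "F \<subseteq> hom G G" "\<And>f x. f \<in> F \<Longrightarrow> x \<in> carrier G \<Longrightarrow> f x \<in> generate G {c}"
    and kill: "\<And>f x. f \<in> F \<Longrightarrow> x \<in> K \<Longrightarrow> f x = \<one>"
    and ext: "F \<subseteq> extensional (carrier G)"
  shows "card F * card K \<le> order G"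
proof -
  define P where "P H \<longleftrightarrow> subgroup H G \<and> K \<subseteq> H \<and> card ((\<lambda>f. restrict f H) ` F) * card K \<le> card H" for H
  have subC: "H \<subseteq> carrier G" if "P H" for H
    using that subgroup.subset by (auto simp: P_def)
  have hom: "group_hom G G f" if "f \<in> F" for f
    using that F(1) by (simp add: group_hom_def group_hom_axioms_def is_group subset_iff)
  have "card ((\<lambda>f. restrict f K) ` F) \<le> 1"
  proof -
    have "(\<lambda>f. restrict f K) ` F \<subseteq> {\<lambda>x\<in>K. \<one>}"
      using kill by (auto simp: fun_eq_iff restrict_def)
    then show ?thesis using card_mono[of "{\<lambda>x\<in>K. \<one>}"] by simp
  qed
  then have PK: "P K" using K by (simp add: P_def)
  have "finite (Collect P)" using fin subC by (intro finite_subset[of "Collect P" "Pow (carrier G)"]) auto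
  then obtain H where H: "P H" and max: "\<And>H'. P H' \<Longrightarrow> H \<subseteq> H' \<Longrightarrow> H = H'"
    using finite_has_maximal2[of "Collect P" K] PK by auto
  have sH: "subgroup H G" using H by (simp add: P_def)
  have "H = carrier G"
  proof (rule ccontr)
    assume "H \<noteq> carrier G"
    then obtain x where x: "x \<in> carrier G" "x \<notin> H" using subC[OF H] by blast
    define m where "m = (LEAST m::nat. m > 0 \<and> x [^] m \<in> H)"
    have "ord x > 0 \<and> x [^] ord x \<in> H"
      using ord_ge_1[OF fin x(1)] x subgroup.one_closed[OF sH] by simp
    then have "m > 0 \<and> x [^] m \<in> H"
      unfolding m_def by (rule LeastI[of "\<lambda>m::nat. m > 0 \<and> x [^] m \<in> H"])
    then have m: "m > 0" "x [^] m \<in> H" by simp_all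
    have m_min: "\<not> (0 < i \<and> x [^] i \<in> H)" if "i < m" for i
      using that not_less_Least unfolding m_def by blast
    define H1 where "H1 = generate G (H \<union> {x})"
    have HxC: "H \<union> {x} \<subseteq> carrier G" using subC[OF H] x by blast
    have sH1: "subgroup H1 G" using HxC by (simp add: H1_def generate_is_subgroup)
    have inH1: "H \<subseteq> H1" "x \<in> H1" by (auto simp: H1_def generate.incl)
    have H1C: "H1 \<subseteq> carrier G" using sH1 subgroup.subset by blast
    have finH1: "finite H1" using H1C fin finite_subset by blast
    have xpow: "x [^] (i::nat) \<in> H1" for i
      using inH1 sH1 by (induction i) (auto simp: subgroup.one_closed subgroup.m_closed)
    \<comment> \<open>a coincidence \<open>h x^i = k x^j\<close> puts \<open>x^(j - i)\<close> into \<open>H\<close>, against the choice of \<open>m\<close>\<close>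
    have inj: "inj_on (\<lambda>(i, h). h \<otimes> x [^] i) ({..<m} \<times> H)"
    proof -
      have le: "i = j \<and> h = k" if ij: "i \<le> j" "j < m" and hk: "h \<in> H" "k \<in> H"
        and eq: "h \<otimes> x [^] i = k \<otimes> x [^] j" for i j h k
      proof -
        have hkC: "h \<in> carrier G" "k \<in> carrier G" using hk subC[OF H] by auto
        have "k \<otimes> x [^] j = k \<otimes> (x [^] (j - i) \<otimes> x [^] i)"
          using ij x by (simp add: nat_pow_mult)
        then have "h \<otimes> x [^] i = (k \<otimes> x [^] (j - i)) \<otimes> x [^] i"
          using eq x hkC by (simp add: m_assoc)
        then have h: "h = k \<otimes> x [^] (j - i)"
          using x hkC by (simp)
        then have "x [^] (j - i) = inv k \<otimes> h" using x hkC by (simp add: m_assoc[symmetric])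
        then have "x [^] (j - i) \<in> H"
          using hk sH by (simp add: subgroup.m_closed subgroup.m_inv_closed)
        then have "i = j" using m_min[of "j - i"] ij by linarith
        then show ?thesis using h hkC by simp
      qed
      show ?thesis
        unfolding inj_on_def
      proof clarsimp
        fix i h j k
        assume a: "i < m" "h \<in> H" "j < m" "k \<in> H" "h \<otimes> x [^] i = k \<otimes> x [^] j"
        show "i = j \<and> h = k"
          using le[of i j h k] le[of j i k h] a by (cases "i \<le> j") auto
      qed
    qed
    have "(\<lambda>(i, h). h \<otimes> x [^] i) ` ({..<m} \<times> H) \<subseteq> H1"
      using sH1 inH1 xpow by (auto simp: subgroup.m_closed)
    then have H1_ge: "m * card H \<le> card H1"
      using card_mono[OF finH1] card_image[OF inj] by (metis card_cartesian_product card_lessThan)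
    define A where "A = (\<lambda>f. restrict f H1) ` F"
    have "A \<subseteq> PiE H1 (\<lambda>_. carrier G)"
    proof -
      have "f y \<in> carrier G" if "f \<in> F" "y \<in> H1" for f y
        using group_hom.hom_closed[OF hom[OF that(1)]] that(2) H1C by blast
      then show ?thesis by (auto simp: A_def PiE_def)
    qed
    then have finA: "finite A" using finH1 fin finite_PiE finite_subset by metis
    have res: "(\<lambda>g. restrict g H) ` A = (\<lambda>f. restrict f H) ` F"
    proof -
      have "restrict (restrict f H1) H = restrict f H" for f :: "'a \<Rightarrow> 'a"
        using inH1(1) by (auto simp: fun_eq_iff restrict_def)
      then show ?thesis by (simp add: A_def image_image)
    qed
    have "card A \<le> m * card ((\<lambda>g. restrict g H) ` A)"
    proof (rule card_le_fibre_bound[OF finA])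
      fix r assume "r \<in> (\<lambda>g. restrict g H) ` A"
      let ?B = "{g \<in> A. restrict g H = r}"
      have "inj_on (\<lambda>g. g x) ?B"
      proof (rule inj_onI)
        fix g g' assume g: "g \<in> ?B" and g': "g' \<in> ?B" and eq: "g x = g' x"
        obtain f f' where f: "f \<in> F" "g = restrict f H1" and f': "f' \<in> F" "g' = restrict f' H1"
          using g g' by (auto simp: A_def)
        have agree: "f y = f' y" if "y \<in> H \<union> {x}" for y
          using that g g' f f' inH1 eq by (auto simp: fun_eq_iff restrict_def split: if_splits) 
        have "f y = f' y" if "y \<in> H1" for y
          using that unfolding H1_def
        proof (induction rule: generate.induct)
          case one then show ?case using group_hom.hom_one[OF hom] f f' by metis
        next
          case (incl h) then show ?case by (rule agree)
        next
          case (inv h) then show ?case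
            using group_hom.hom_inv[OF hom[OF f(1)]] group_hom.hom_inv[OF hom[OF f'(1)]] HxC agree
            by (metis subsetD)
        next
          case (eng h1 h2)
          then have "h1 \<in> carrier G" "h2 \<in> carrier G" using generate_in_carrier[OF HxC] by auto
          then show ?case
            using group_hom.hom_mult[OF hom[OF f(1)]] group_hom.hom_mult[OF hom[OF f'(1)]] eng by simp
        qed
        then show "g = g'" using f f' by (auto simp: restrict_def)
      qed
      moreover have "(\<lambda>g. g x) ` ?B \<subseteq> {y \<in> generate G {c}. y [^] m = r (x [^] m)}"
      proof clarify
        fix g assume "g \<in> A"
        then obtain f where f: "f \<in> F" "g = restrict f H1" by (auto simp: A_def)
        have "f (x [^] m) = f x [^] m"
          using group_hom.hom_nat_pow[OF hom[OF f(1)] x(1)] by simp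
        then show "g x \<in> generate G {c} \<and> g x [^] m = restrict g H (x [^] m)"
          using f F(2) x inH1 m xpow by simp
      qed
      moreover have "finite {y \<in> generate G {c}. y [^] m = r (x [^] m)}"
        by (rule finite_subset[OF _ fin]) (use c generate_incl[of "{c}"] in auto)
      ultimately have "card ?B \<le> card {y \<in> generate G {c}. y [^] m = r (x [^] m)}"
        by (intro card_inj_on_le)
      then show "card ?B \<le> m" using card_roots_cyclic_le[OF fin c m(1), of "r (x [^] m)"] by linarith
    qed
    then have "card A * card K \<le> m * (card ((\<lambda>f. restrict f H) ` F) * card K)"
      unfolding res by (metis mult.assoc mult_le_mono1)
    also have "\<dots> \<le> m * card H" using H by (simp add: P_def)
    finally have "P H1" using sH1 inH1 H1_ge H by (auto simp: P_def A_def)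
    then show False using max[of H1] inH1 x by blast
  qed
  moreover have "(\<lambda>f. restrict f (carrier G)) ` F = F"
    using ext by (force simp: image_iff extensional_restrict subset_iff)
  ultimately show ?thesis using H by (simp add: P_def order_def)
qed

section \<open>Constructing homomorphisms into a cyclic group\<close>

lemma (in group) normal_if_contains_derived:
  assumes K: "subgroup K G" and der: "derived G (carrier G) \<subseteq> K"
  shows "K \<lhd> G"
  unfolding normal_inv_iff
proof (intro conjI ballI K)
  fix x h assume x: "x \<in> carrier G" and h: "h \<in> K"
  have hC: "h \<in> carrier G" using K h subgroup.mem_carrier by metis
  have "x \<otimes> h \<otimes> inv x \<otimes> inv h \<in> derived G (carrier G)"
    unfolding derived_def using x hC by (intro generate.incl) blast
  then have "x \<otimes> h \<otimes> inv x \<otimes> inv h \<otimes> h \<in> K"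
    using der h K subgroup.m_closed by (metis subsetD)
  then show "x \<otimes> h \<otimes> inv x \<in> K" using x hC by (simp add: m_assoc)
qed

lemma (in group) comm_group_Mod_if_contains_derived:
  assumes K: "subgroup K G" and der: "derived G (carrier G) \<subseteq> K"
  shows "comm_group (G Mod K)"
proof -
  interpret N: normal K G using normal_if_contains_derived[OF assms] .
  interpret Q: group "G Mod K" by (rule N.factorgroup_is_group)
  show ?thesis
  proof (rule Q.group_comm_groupI)
    fix U Y assume "U \<in> carrier (G Mod K)" "Y \<in> carrier (G Mod K)"
    then obtain x y where xy: "x \<in> carrier G" "y \<in> carrier G" "U = K #> x" "Y = K #> y"
      by (auto simp: carrier_FactGroup)
    have "x \<otimes> y \<otimes> inv x \<otimes> inv y \<in> derived G (carrier G)"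
      unfolding derived_def using xy by (intro generate.incl) blast
    then have "(x \<otimes> y) \<otimes> inv (y \<otimes> x) \<in> K"
      using der xy by (auto simp: inv_mult_group m_assoc)
    then have "x \<otimes> y \<in> K #> (y \<otimes> x)" using xy N.rcos_module[OF is_group] by simp
    then have "K #> (y \<otimes> x) = K #> (x \<otimes> y)" using xy by (intro repr_independence N.is_subgroup) auto
    then show "U \<otimes>\<^bsub>G Mod K\<^esub> Y = Y \<otimes>\<^bsub>G Mod K\<^esub> U"
      using xy by (simp add: N.rcos_sum)
  qed
qed

lemma (in group) ord_eq_prime:
  fixes p :: nat
  assumes "Factorial_Ring.prime p" "x \<in> carrier G" "x [^] p = \<one>" "x \<noteq> \<one>"
  shows "ord x = p"
  using assms by (metis ord_eq_1 pow_eq_id prime_nat_iff)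

lemma (in group) generate_eq_if_prime_order:
  fixes p :: nat
  assumes fin: "finite (carrier G)" and p: "Factorial_Ring.prime p"
    and x: "x \<in> carrier G" "x [^] p = \<one>" and y: "y \<in> generate G {x}" "y \<noteq> \<one>"
  shows "y [^] p = \<one>" "generate G {y} = generate G {x}"
proof -
  obtain i :: nat where i: "y = x [^] i" using y generate_singleton_nat[OF fin x(1)] by auto
  have yC: "y \<in> carrier G" using i x by simp
  have "y [^] p = (x [^] p) [^] i" using x(1) by (simp only: i nat_pow_pow mult.commute[of i p])
  then show yp: "y [^] p = \<one>" using x by simp
  have "x \<noteq> \<one>" using i y(2) by auto
  then have "card (generate G {y}) = card (generate G {x})"
    using ord_eq_prime[OF p x] ord_eq_prime[OF p yC yp y(2)] x yC by (simp flip: generate_pow_card)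
  moreover have "generate G {y} \<subseteq> generate G {x}"
    using x(1) y by (intro generate_subgroup_incl generate_is_subgroup) auto
  moreover have "finite (generate G {x})"
    using fin x generate_incl[of "{x}"] finite_subset by blast
  ultimately show "generate G {y} = generate G {x}" by (intro card_subset_eq)
qed

text \<open>If \<open>x\<close> has order \<open>p\<close>, then \<open>a \<in> \<langle>x\<rangle>\<close> forces \<open>\<langle>a\<rangle> = \<langle>x\<rangle>\<close>. So all elements of order \<open>p\<close> lie in the
  one subgroup \<open>\<langle>a\<rangle>\<close> of order \<open>p\<close>.\<close>

lemma (in group) card_roots_le_if_common_power:
  assumes fin: "finite (carrier G)" and p: "Factorial_Ring.prime p"
    and a: "a \<in> carrier G" "a \<noteq> \<one>"
    and common: "\<And>x. x \<in> carrier G \<Longrightarrow> x \<noteq> \<one> \<Longrightarrow> \<exists>i::nat. a = x [^] i"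
  shows "card {x \<in> carrier G. x [^] p = \<one>} \<le> p"
proof (cases "{x \<in> carrier G. x [^] p = \<one>} \<subseteq> {\<one>}")
  case True
  then have "card {x \<in> carrier G. x [^] p = \<one>} \<le> 1"
    using card_mono[of "{\<one>}"] by simp
  then show ?thesis using prime_ge_1_nat[OF p] by linarith
next
  case False
  have root: "a [^] p = \<one>" "x \<in> generate G {a}"
    if x: "x \<in> carrier G" "x [^] p = \<one>" "x \<noteq> \<one>" for x
  proof -
    have "a \<in> generate G {x}" using common x generate_singleton_nat[OF fin x(1)] by auto
    note eq = generate_eq_if_prime_order[OF fin p x(1,2) this a(2)]
    show "a [^] p = \<one>" by (rule eq(1))
    show "x \<in> generate G {a}" unfolding eq(2) by (simp add: generate.incl)
  qed
  have "a [^] p = \<one>" using False root by blast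
  then have "card (generate G {a}) = p" using ord_eq_prime[OF p a(1)] a by (simp flip: generate_pow_card)
  moreover have "{x \<in> carrier G. x [^] p = \<one>} \<subseteq> generate G {a}"
    using root generate.one by blast
  moreover have "finite (generate G {a})"
    using fin a generate_incl[of "{a}"] finite_subset by blast
  ultimately show ?thesis using card_mono by metis
qed

text \<open>Take \<open>M\<close> maximal among the subgroups that contain \<open>K\<close> but not \<open>a\<close>. Every nontrivial subgroup of
  the abelian \<open>p\<close>-group \<open>G/M\<close> then contains the image of \<open>a\<close>, so \<open>G/M\<close> has only one subgroup of
  order \<open>p\<close> and is therefore cyclic. The last two conclusions describe this quotient without
  mentioning cosets: \<open>G/M\<close> is generated by the image of \<open>x\<close>, whose order is divisible by \<open>p\<close>.\<close>

lemma (in group) cyclic_quotient_avoiding: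
  assumes p: "Factorial_Ring.prime p" and ord: "order G = p ^ e"
    and K: "subgroup K G" "derived G (carrier G) \<subseteq> K"
    and a: "a \<in> carrier G" "a \<notin> K"
  obtains M x j where "subgroup M G" "K \<subseteq> M" "a \<notin> M" "x \<in> carrier G"
    "\<forall>g\<in>carrier G. \<exists>k\<in>M. \<exists>i::nat. g = k \<otimes> x [^] i"
    "\<forall>i::nat. x [^] i \<in> M \<longleftrightarrow> p ^ Suc j dvd i"
proof -
  have p1: "p > 1" by (rule prime_gt_1_nat[OF p])
  have fin: "finite (carrier G)"
    using ord p1 order_gt_0_iff_finite by simp
  let ?S = "{M. subgroup M G \<and> K \<subseteq> M \<and> a \<notin> M}"
  have "finite ?S"
    using fin subgroup.subset by (intro finite_subset[of ?S "Pow (carrier G)"]) auto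
  then obtain M where M: "subgroup M G" "K \<subseteq> M" "a \<notin> M"
    and max: "\<And>M'. subgroup M' G \<Longrightarrow> M \<subseteq> M' \<Longrightarrow> a \<notin> M' \<Longrightarrow> M = M'"
    using finite_has_maximal2[of ?S K] K a by auto
  have derM: "derived G (carrier G) \<subseteq> M" using K M by blast
  interpret N: normal M G using normal_if_contains_derived[OF M(1) derM] .
  interpret Q: comm_group "G Mod M" by (rule comm_group_Mod_if_contains_derived[OF M(1) derM])
  have finQ: "finite (carrier (G Mod M))" using fin by (simp add: carrier_FactGroup)
  have "order (G Mod M) dvd p ^ e"
    using lagrange[OF M(1)] ord by (metis FactGroup_def dvd_triv_left order_def partial_object.simps(1))
  then obtain e' where ordQ: "order (G Mod M) = p ^ e'"
    using p divides_primepow_nat by blast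
  have one_iff: "M #> x = \<one>\<^bsub>G Mod M\<^esub> \<longleftrightarrow> x \<in> M" if "x \<in> carrier G" for x
    using that coset_join1[OF _ that M(1)] coset_join2[OF that M(1)] N.subset by auto
  have inQ: "M #> x \<in> carrier (G Mod M)" if "x \<in> carrier G" for x
    using that by (simp add: carrier_FactGroup)
  have common: "\<exists>i::nat. M #> a = Y [^]\<^bsub>G Mod M\<^esub> i"
    if Y: "Y \<in> carrier (G Mod M)" "Y \<noteq> \<one>\<^bsub>G Mod M\<^esub>" for Y
  proof -
    obtain y where y: "y \<in> carrier G" "Y = M #> y" using Y by (auto simp: carrier_FactGroup)
    then have "y \<notin> M" using Y one_iff by blast
    have gen: "subgroup (generate G {y}) G" using y by (simp add: generate_is_subgroup)
    interpret S: second_isomorphism_grp M G "generate G {y}"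
      by (intro second_isomorphism_grp.intro second_isomorphism_grp_axioms.intro N.normal_axioms gen)
    have "y \<in> M <#> generate G {y}"
      using S.S_contained_in_set_mult by (auto intro: generate.incl)
    \<comment> \<open>maximality of \<open>M\<close> forces \<open>a\<close> into the larger subgroup \<open>M \<langle>y\<rangle>\<close>\<close>
    then have "M \<noteq> M <#> generate G {y}" using \<open>y \<notin> M\<close> by blast
    then have "a \<in> M <#> generate G {y}"
      using max[OF S.normal_set_mult_subgroup S.H_contained_in_set_mult] by blast
    then obtain k i where ki: "k \<in> M" "a = k \<otimes> y [^] (i::nat)"
      unfolding set_mult_def generate_singleton_nat[OF fin y(1)] by blast
    have "a \<in> M #> y [^] i" using ki by (auto simp: r_coset_def)
    then have "M #> a = M #> y [^] i"
      using repr_independence[OF _ _ M(1)] y by (metis nat_pow_closed)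
    then show ?thesis using y N.FactGroup_pow by metis
  qed
  have "card {U \<in> carrier (G Mod M). U [^]\<^bsub>G Mod M\<^esub> p = \<one>\<^bsub>G Mod M\<^esub>} \<le> p"
    using Q.card_roots_le_if_common_power[OF finQ p inQ[OF a(1)]] one_iff[OF a(1)] M(3) common by blast
  from Q.p_group_cyclic_if_few_roots[OF p ordQ this]
  obtain U where U: "U \<in> carrier (G Mod M)" "generate (G Mod M) {U} = carrier (G Mod M)" .
  obtain x where x: "x \<in> carrier G" "U = M #> x" using U by (auto simp: carrier_FactGroup)
  have gen: "\<exists>k\<in>M. \<exists>i::nat. g = k \<otimes> x [^] i" if g: "g \<in> carrier G" for g
  proof -
    have "M #> g \<in> generate (G Mod M) {U}" using inQ[OF g] U by simp
    then obtain i :: nat where "M #> g = U [^]\<^bsub>G Mod M\<^esub> i"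
      using Q.generate_singleton_nat[OF finQ U(1)] by auto
    then have "g \<in> M #> x [^] i" using x N.FactGroup_pow rcos_self[OF g M(1)] by simp
    then show ?thesis by (auto simp: r_coset_def)
  qed
  have "Q.ord U dvd p ^ e'" using Q.ord_dvd_group_order[OF U(1)] ordQ by simp
  then obtain j where j: "Q.ord U = p ^ j" using p divides_primepow_nat by blast
  have pow_iff: "x [^] i \<in> M \<longleftrightarrow> p ^ j dvd i" for i :: nat
    using one_iff[of "x [^] i"] x N.FactGroup_pow[OF x(1)] Q.pow_eq_id[OF U(1)] j by simp
  have "x \<notin> M"
  proof
    assume "x \<in> M"
    then have pw: "x [^] i \<in> M" for i :: nat
      by (induction i) (simp_all add: M(1) subgroup.m_closed)
    obtain k i where "k \<in> M" "a = k \<otimes> x [^] (i::nat)" using gen[OF a(1)] by blast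
    then show False using pw M(1,3) subgroup.m_closed by metis
  qed
  then obtain j' where "j = Suc j'" using pow_iff[of 1] x by (cases j) auto
  then show ?thesis using that[OF M x(1), of j'] gen pow_iff by blast
qed

text \<open>The homomorphism is \<open>G \<rightarrow> G/K \<rightarrow> \<langle>c\<rangle>\<close>; the condition on \<open>c\<close> makes \<open>k x^i \<mapsto> c^i\<close> independent of the
  choice of \<open>i\<close>.\<close>

lemma (in group) hom_on_cyclic_quotient:
  assumes K: "subgroup K G" "derived G (carrier G) \<subseteq> K"
    and x: "x \<in> carrier G" and gen: "\<forall>g\<in>carrier G. \<exists>k\<in>K. \<exists>i::nat. g = k \<otimes> x [^] i"
    and c: "c \<in> carrier G" and compat: "\<forall>i::nat. x [^] i \<in> K \<longrightarrow> c [^] i = \<one>"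
  obtains f where "f \<in> hom G G" "\<forall>k\<in>K. \<forall>i::nat. f (k \<otimes> x [^] i) = c [^] i"
proof -
  interpret N: normal K G using normal_if_contains_derived[OF K] .
  define f where "f g = c [^] (SOME i::nat. \<exists>k\<in>K. g = k \<otimes> x [^] i)" for g
  have le: "c [^] i = c [^] j"
    if ij: "i \<le> j" and hk: "h \<in> K" "k \<in> K" and eq: "h \<otimes> x [^] i = k \<otimes> x [^] j"
    for i j :: nat and h k
  proof -
    have hkC: "h \<in> carrier G" "k \<in> carrier G" using hk by auto
    have "h \<otimes> x [^] i = (k \<otimes> x [^] (j - i)) \<otimes> x [^] i"
      using eq ij x hkC by (simp add: m_assoc nat_pow_mult)
    then have "h = k \<otimes> x [^] (j - i)" using x hkC by simp
    then have "x [^] (j - i) = inv k \<otimes> h" using x hkC by (simp add: m_assoc[symmetric])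
    then have "c [^] (j - i) = \<one>" using hk compat by simp
    then have "c [^] (j - i) \<otimes> c [^] i = c [^] i" using c by simp
    then show ?thesis using ij c by (simp add: nat_pow_mult)
  qed
  have f: "f (k \<otimes> x [^] i) = c [^] i" if k: "k \<in> K" for k and i :: nat
  proof -
    define i' where "i' = (SOME i'::nat. \<exists>k'\<in>K. k \<otimes> x [^] i = k' \<otimes> x [^] i')"
    have "\<exists>k'\<in>K. k \<otimes> x [^] i = k' \<otimes> x [^] i'"
      unfolding i'_def using someI[of "\<lambda>i'. \<exists>k'\<in>K. k \<otimes> x [^] i = k' \<otimes> x [^] i'" i] k by auto
    then obtain k' where k': "k' \<in> K" "k \<otimes> x [^] i = k' \<otimes> x [^] i'" by blast
    have "c [^] i' = c [^] i"
      using le[OF _ k k'(1) k'(2)] le[OF _ k'(1) k k'(2)[symmetric]] by (metis nle_le)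
    then show ?thesis by (simp add: f_def i'_def)
  qed
  have "f \<in> hom G G"
  proof (rule homI)
    fix g assume "g \<in> carrier G"
    then obtain k i where "k \<in> K" "g = k \<otimes> x [^] (i::nat)" using gen by blast
    then show "f g \<in> carrier G" using f c by simp
  next
    fix g h assume "g \<in> carrier G" "h \<in> carrier G"
    then obtain k i l j where kl: "k \<in> K" "g = k \<otimes> x [^] (i::nat)" "l \<in> K" "h = l \<otimes> x [^] (j::nat)"
      using gen by meson
    \<comment> \<open>\<open>l\<close> is moved past \<open>x^i\<close> by conjugation, which keeps it in the normal subgroup \<open>K\<close>\<close>
    define l' where "l' = x [^] i \<otimes> l \<otimes> inv (x [^] i)"
    have l': "l' \<in> K" using kl x by (simp add: l'_def N.inv_op_closed2)
    have "l' \<otimes> x [^] i = x [^] i \<otimes> l" using kl x by (simp add: l'_def m_assoc)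
    then have "g \<otimes> h = (k \<otimes> l') \<otimes> x [^] (i + j)"
      using kl l' x by (simp add: m_assoc flip: nat_pow_mult) (simp flip: m_assoc)
    then show "f (g \<otimes> h) = f g \<otimes> f h"
      using kl l' f c by (simp add: nat_pow_mult)
  qed
  then show ?thesis using that f by blast
qed

text \<open>Characters of an abelian \<open>p\<close>-group separate points, already when their values are taken in a cyclic
  group whose order is a multiple of the exponent. Passing to a cyclic quotient \<open>G/M\<close> of order \<open>m\<close>
  in which \<open>a\<close> survives, \<open>m\<close> divides the order of \<open>c\<close>, and \<open>G/M\<close> embeds into \<open>\<langle>c\<rangle>\<close>.\<close>

lemma (in group) homs_to_cyclic_separate:
  assumes p: "Factorial_Ring.prime p" and ord: "order G = p ^ e"
    and K: "subgroup K G" "derived G (carrier G) \<subseteq> K"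
    and c: "c \<in> carrier G" and exp: "\<And>x. x \<in> carrier G \<Longrightarrow> x [^] ord c \<in> K"
    and a: "a \<in> carrier G" "a \<notin> K"
  obtains f where "f \<in> hom G G" "\<forall>x\<in>carrier G. f x \<in> generate G {c}"
    "\<forall>k\<in>K. f k = \<one>" "f a \<noteq> \<one>"
proof -
  from cyclic_quotient_avoiding[OF p ord K a]
  obtain M x j where M: "subgroup M G" "K \<subseteq> M" "a \<notin> M" and x: "x \<in> carrier G"
    and gen: "\<forall>g\<in>carrier G. \<exists>k\<in>M. \<exists>i::nat. g = k \<otimes> x [^] i"
    and pow_iff: "\<forall>i::nat. x [^] i \<in> M \<longleftrightarrow> p ^ Suc j dvd i" .
  define m where "m = p ^ Suc j"
  have fin: "finite (carrier G)"
    using ord prime_gt_0_nat[OF p] order_gt_0_iff_finite by simp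
  have "m dvd ord c" using exp[OF x] pow_iff M(2) by (auto simp: m_def)
  moreover have "ord c > 0" using ord_ge_1[OF fin c] by simp
  moreover define d where "d = c [^] (ord c div m)"
  ultimately have d: "d \<in> carrier G" "ord d = m"
    using c by (auto simp: ord_pow div_div_eq_right elim!: dvdE)
  have d_iff: "d [^] i = \<one> \<longleftrightarrow> x [^] i \<in> M" for i :: nat
    using d pow_iff by (simp add: pow_eq_id m_def)
  have derM: "derived G (carrier G) \<subseteq> M" using K(2) M(2) by blast
  from hom_on_cyclic_quotient[OF M(1) derM x gen d(1)] d_iff
  obtain f where f: "f \<in> hom G G" "\<forall>k\<in>M. \<forall>i::nat. f (k \<otimes> x [^] i) = d [^] i" by blast
  show ?thesis
  proof (rule that[OF f(1)]; (intro ballI)?)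
    fix g assume "g \<in> carrier G"
    then obtain k i where "k \<in> M" "g = k \<otimes> x [^] (i::nat)" using gen by blast
    then show "f g \<in> generate G {c}"
      using f c by (simp add: d_def nat_pow_pow generate_singleton_nat[OF fin c])
  next
    fix k assume "k \<in> K"
    then have "k \<in> M" "k \<in> carrier G" using M(2) subgroup.subset[OF M(1)] by auto
    moreover have "f (k \<otimes> x [^] (0::nat)) = d [^] (0::nat)" using f(2) \<open>k \<in> M\<close> by blast
    ultimately show "f k = \<one>" by simp
  next
    obtain k i where ki: "k \<in> M" "a = k \<otimes> x [^] (i::nat)" using gen a by blast
    then have "x [^] i \<notin> M" using M(1,3) subgroup.m_closed by metis
    then show "f a \<noteq> \<one>" using ki f d_iff by simp
  qed
qed

section \<open>Exponents, cyclic subgroups and the centre\<close>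

text \<open>The element orders are powers of \<open>p\<close>, hence totally ordered by divisibility; the largest of them
  is the exponent.\<close>

lemma (in group) p_group_exponent_attained:
  assumes p: "Factorial_Ring.prime p" and ordG: "order G = p ^ e"
  obtains c where "c \<in> carrier G" "ord c = group_exponent G"
    "\<forall>x\<in>carrier G. x [^] group_exponent G = \<one>"
proof -
  have fin: "finite (carrier G)"
    using ordG prime_gt_0_nat[OF p] order_gt_0_iff_finite by simp
  have fino: "finite (ord ` carrier G)" using fin by simp
  then have "Max (ord ` carrier G) \<in> ord ` carrier G" by (intro Max_in) auto
  then obtain c where c: "c \<in> carrier G" "ord c = Max (ord ` carrier G)" by auto
  have p_power: "\<exists>i. ord x = p ^ i" if "x \<in> carrier G" for x
    using ord_dvd_group_order[OF that] ordG p divides_primepow_nat by auto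
  have all: "x [^] ord c = \<one>" if x: "x \<in> carrier G" for x
  proof -
    obtain i j where ij: "ord x = p ^ i" "ord c = p ^ j" using p_power x c by metis
    have "ord x \<le> ord c" unfolding c(2) using fino x by (intro Max_ge) auto
    then have "ord x dvd ord c"
      using ij prime_gt_1_nat[OF p] by (simp add: le_imp_power_dvd)
    then show ?thesis using x by (simp add: pow_eq_id)
  qed
  have "group_exponent G = ord c"
    unfolding group_exponent_def
  proof (rule Least_equality)
    show "0 < ord c \<and> (\<forall>x\<in>carrier G. x [^] ord c = \<one>)"
      using all ord_ge_1[OF fin c(1)] by simp
  next
    fix m :: nat assume "0 < m \<and> (\<forall>x\<in>carrier G. x [^] m = \<one>)"
    then show "ord c \<le> m" using c(1) by (auto simp: pow_eq_id intro: dvd_imp_le)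
  qed
  then show ?thesis using that[OF c(1)] all by simp
qed

lemma (in group) cyclic_subgroup_iff:
  assumes "subgroup H G"
  shows "cyclic_group (G\<lparr>carrier := H\<rparr>) \<longleftrightarrow> (\<exists>x\<in>H. generate G {x} = H)"
proof -
  have "subgroup_generated (G\<lparr>carrier := H\<rparr>) {x} = G\<lparr>carrier := H\<rparr> \<longleftrightarrow> generate G {x} = H"
    if x: "x \<in> H" for x
  proof -
    have "generate (G\<lparr>carrier := H\<rparr>) {x} = generate G {x}"
      using x assms by (intro generate_consistent) auto
    then have "subgroup_generated (G\<lparr>carrier := H\<rparr>) {x} = G\<lparr>carrier := generate G {x}\<rparr>"
      using x by (simp add: subgroup_generated_def)
    moreover have "G\<lparr>carrier := generate G {x}\<rparr> = G\<lparr>carrier := H\<rparr> \<longleftrightarrow> generate G {x} = H"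
      by (metis partial_object.select_convs(1) partial_object.surjective partial_object.update_convs(1))
    ultimately show ?thesis by simp
  qed
  then show ?thesis by (auto simp: cyclic_group_def)
qed

lemma (in group) subgroup_centre: "subgroup (centre G) G"
proof (rule subgroupI)
  fix a assume a: "a \<in> centre G"
  then have aC: "a \<in> carrier G" and ac: "\<And>g. g \<in> carrier G \<Longrightarrow> a \<otimes> g = g \<otimes> a"
    by (simp_all add: centre_def)
  have "inv a \<otimes> g = g \<otimes> inv a" if g: "g \<in> carrier G" for g
  proof -
    have "inv a \<otimes> g = inv a \<otimes> (g \<otimes> a) \<otimes> inv a" using aC g by (simp add: m_assoc)
    also have "\<dots> = g \<otimes> inv a" unfolding ac[OF g, symmetric] using aC g by (simp flip: m_assoc)
    finally show ?thesis .
  qed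
  then show "inv a \<in> centre G" using aC by (simp add: centre_def)
  fix b assume b: "b \<in> centre G"
  have "a \<otimes> b \<otimes> g = g \<otimes> (a \<otimes> b)" if g: "g \<in> carrier G" for g
  proof -
    have bC: "b \<in> carrier G" "b \<otimes> g = g \<otimes> b" using b g by (simp_all add: centre_def)
    have "a \<otimes> b \<otimes> g = a \<otimes> g \<otimes> b" using aC bC g by (simp add: m_assoc)
    also have "\<dots> = g \<otimes> (a \<otimes> b)" using aC bC g by (simp add: ac m_assoc)
    finally show ?thesis .
  qed
  then show "a \<otimes> b \<in> centre G" using aC b by (simp add: centre_def)
qed (auto simp: centre_def)

section \<open>Absolute central automorphisms as homomorphisms into the absolute centre\<close>

lemma (in group) conjugation_in_auto:
  assumes g: "g \<in> carrier G"
  shows "(\<lambda>x \<in> carrier G. g \<otimes> x \<otimes> inv g) \<in> auto G"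
proof -
  have "bij_betw (\<lambda>x. g \<otimes> x \<otimes> inv g) (carrier G) (carrier G)"
    by (rule bij_betwI[where g = "\<lambda>x. inv g \<otimes> x \<otimes> g"]) (use g in \<open>auto simp: m_assoc\<close>, (use g in \<open>auto simp flip: m_assoc\<close>))
  moreover have "(\<lambda>x \<in> carrier G. g \<otimes> x \<otimes> inv g) \<in> hom G G"
  proof (rule homI)
    fix x y assume "x \<in> carrier G" "y \<in> carrier G"
    moreover then have "inv g \<otimes> (g \<otimes> (y \<otimes> inv g)) = y \<otimes> inv g" using g by (simp flip: m_assoc)
    ultimately show "(\<lambda>x \<in> carrier G. g \<otimes> x \<otimes> inv g) (x \<otimes> y)
      = (\<lambda>x \<in> carrier G. g \<otimes> x \<otimes> inv g) x \<otimes> (\<lambda>x \<in> carrier G. g \<otimes> x \<otimes> inv g) y"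
      using g by (simp add: m_assoc)
  qed (use g in auto)
  ultimately show ?thesis by (simp add: auto_def Bij_def bij_betw_restrict_eq)
qed

text \<open>An element fixed by all inner automorphisms is central.\<close>

lemma (in group) absolute_centre_subset_centre: "absolute_centre G \<subseteq> centre G"
proof
  fix z assume z: "z \<in> absolute_centre G"
  then have zC: "z \<in> carrier G" by (simp add: absolute_centre_def)
  have "z \<otimes> g = g \<otimes> z" if g: "g \<in> carrier G" for g
  proof -
    have "g \<otimes> z \<otimes> inv g = z"
      using absolute_centre_fixed[OF z conjugation_in_auto[OF g]] zC by simp
    then show ?thesis using g zC by (metis inv_solve_right m_closed)
  qed
  then show "z \<in> centre G" using zC by (simp add: centre_def)
qed

lemma (in group) absolute_centre_commutes:
  assumes "z \<in> absolute_centre G" "g \<in> carrier G"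
  shows "z \<otimes> g = g \<otimes> z"
  using assms absolute_centre_subset_centre by (auto simp: centre_def)

text \<open>As \<open>L(G)\<close> is central, \<open>x \<mapsto> x f(x)\<close> is an endomorphism. It is injective because \<open>x f(x) = 1\<close> puts
  \<open>x\<close> into \<open>L(G)\<close>, where \<open>f\<close> vanishes.\<close>

lemma (in group) absolute_central_auto_of_hom:
  assumes fin: "finite (carrier G)" and f: "f \<in> hom G G"
    and into: "\<forall>x\<in>carrier G. f x \<in> absolute_centre G"
    and kill: "\<forall>x\<in>absolute_centre G. f x = \<one>"
  shows "(\<lambda>x \<in> carrier G. x \<otimes> f x) \<in> absolute_central_auto G"
proof -
  interpret f: group_hom G G f by unfold_locales (rule f)
  let ?\<alpha> = "\<lambda>x \<in> carrier G. x \<otimes> f x"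
  have hom: "?\<alpha> \<in> hom G G"
  proof (rule homI)
    fix x y assume xy: "x \<in> carrier G" "y \<in> carrier G"
    then have "f x \<otimes> (y \<otimes> f y) = y \<otimes> (f x \<otimes> f y)"
      using absolute_centre_commutes[of "f x" y] into by (simp flip: m_assoc)
    then show "?\<alpha> (x \<otimes> y) = ?\<alpha> x \<otimes> ?\<alpha> y" using xy by (simp add: m_assoc)
  qed auto
  interpret \<alpha>: group_hom G G ?\<alpha> by unfold_locales (rule hom)
  have "inj_on ?\<alpha> (carrier G)"
    unfolding \<alpha>.inj_on_one_iff
  proof (intro allI impI)
    fix x assume x: "x \<in> carrier G" "?\<alpha> x = \<one>"
    then have fx: "x \<otimes> f x = \<one>" by simp
    then have "x = inv (f x)" using x by (metis f.hom_closed inv_equality inv_inv)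
    then have "x \<in> absolute_centre G"
      using into x subgroup.m_inv_closed[OF subgroup_absolute_centre] by metis
    then show "x = \<one>" using kill fx x by simp
  qed
  moreover have "?\<alpha> ` carrier G \<subseteq> carrier G" by auto
  ultimately have "bij_betw ?\<alpha> (carrier G) (carrier G)"
    using endo_inj_surj[OF fin] by (simp add: bij_betw_def)
  then have "?\<alpha> \<in> auto G" using hom by (simp add: auto_def Bij_def)
  moreover have "inv x \<otimes> ?\<alpha> x = f x" if "x \<in> carrier G" for x
    using that by (simp flip: m_assoc)
  ultimately show ?thesis using into by (simp add: absolute_central_auto_def)
qed

text \<open>The map \<open>x \<mapsto> inv x \<otimes> \<alpha> x\<close> is restricted to the carrier so that displacements, like
  automorphisms, are determined by their values there and can be counted.\<close>

definition displacement :: "('a, 'b) monoid_scheme \<Rightarrow> ('a \<Rightarrow> 'a) \<Rightarrow> 'a \<Rightarrow> 'a" where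
  "displacement G \<alpha> = (\<lambda>x \<in> carrier G. inv\<^bsub>G\<^esub> x \<otimes>\<^bsub>G\<^esub> \<alpha> x)"

text \<open>The displacement vanishes on \<open>L(G)\<close> because automorphisms fix \<open>L(G)\<close> pointwise. Together with
  the previous construction this identifies the absolute central automorphisms with
  \<open>Hom(G/L(G), L(G))\<close>.\<close>

lemma (in group) displacement_hom:
  assumes \<alpha>: "\<alpha> \<in> absolute_central_auto G"
  shows "displacement G \<alpha> \<in> hom G G"
    and "\<forall>x\<in>carrier G. displacement G \<alpha> x \<in> absolute_centre G"
    and "\<forall>x\<in>absolute_centre G. displacement G \<alpha> x = \<one>"
proof -
  let ?f = "displacement G \<alpha>"
  have auto: "\<alpha> \<in> auto G" using \<alpha> by (simp add: absolute_central_auto_def)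
  interpret \<alpha>: group_hom G G \<alpha> by unfold_locales (use auto in \<open>simp add: auto_def\<close>)
  show into: "\<forall>x\<in>carrier G. ?f x \<in> absolute_centre G"
    using \<alpha> by (simp add: absolute_central_auto_def displacement_def)
  show "?f \<in> hom G G"
  proof (rule homI)
    fix x y assume xy: "x \<in> carrier G" "y \<in> carrier G"
    have "?f (x \<otimes> y) = inv y \<otimes> (?f x \<otimes> \<alpha> y)"
      using xy by (simp add: displacement_def inv_mult_group m_assoc)
    also have "?f x \<otimes> \<alpha> y = \<alpha> y \<otimes> ?f x"
      using into xy by (intro absolute_centre_commutes) auto
    also have "inv y \<otimes> (\<alpha> y \<otimes> ?f x) = ?f y \<otimes> ?f x"
      using xy by (simp add: displacement_def m_assoc)
    also have "\<dots> = ?f x \<otimes> ?f y"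
      using into xy by (intro absolute_centre_commutes) (auto simp: displacement_def)
    finally show "?f (x \<otimes> y) = ?f x \<otimes> ?f y" .
  qed (simp add: displacement_def)
  show "\<forall>x\<in>absolute_centre G. ?f x = \<one>"
    using absolute_centre_fixed[OF _ auto] by (auto simp: displacement_def absolute_centre_def)
qed

lemma (in group) inj_on_displacement: "inj_on (displacement G) (absolute_central_auto G)"
proof (rule inj_onI)
  fix \<alpha> \<beta> assume ab: "\<alpha> \<in> absolute_central_auto G" "\<beta> \<in> absolute_central_auto G"
    and eq: "displacement G \<alpha> = displacement G \<beta>"
  have auto: "\<alpha> \<in> auto G" "\<beta> \<in> auto G" using ab by (simp_all add: absolute_central_auto_def)
  have "\<alpha> x = \<beta> x" if x: "x \<in> carrier G" for x
  proof -
    have "\<alpha> x \<in> carrier G" "\<beta> x \<in> carrier G" using auto x by (auto simp: auto_def hom_def)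
    then show ?thesis using fun_cong[OF eq, of x] x by (simp add: displacement_def)
  qed
  then show "\<alpha> = \<beta>" using auto by (intro extensionalityI) (auto simp: auto_def Bij_def)
qed

section \<open>The commutator pairing\<close>

text \<open>For fixed \<open>g\<close> this is \<open>x \<mapsto> [inv x, g]\<close>; introducing it as a displacement makes it a
  homomorphism as soon as conjugation by \<open>g\<close> is absolute central.\<close>

definition commutator_map :: "('a, 'b) monoid_scheme \<Rightarrow> 'a \<Rightarrow> 'a \<Rightarrow> 'a" where
  "commutator_map G g = displacement G (\<lambda>x \<in> carrier G. g \<otimes>\<^bsub>G\<^esub> x \<otimes>\<^bsub>G\<^esub> inv\<^bsub>G\<^esub> g)"

lemma (in group) commutator_map_eq:
  "x \<in> carrier G \<Longrightarrow> commutator_map G g x = inv x \<otimes> (g \<otimes> x \<otimes> inv g)"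
  by (simp add: commutator_map_def displacement_def)

lemma (in group) commutator_map_eq_one_iff:
  assumes "g \<in> carrier G" "x \<in> carrier G"
  shows "commutator_map G g x = \<one> \<longleftrightarrow> g \<otimes> x = x \<otimes> g"
proof -
  have "inv x \<otimes> (g \<otimes> x \<otimes> inv g) = \<one> \<longleftrightarrow> g \<otimes> x \<otimes> inv g = x"
    using assms by (metis inv_closed inv_equality inv_inv l_inv m_closed)
  also have "\<dots> \<longleftrightarrow> g \<otimes> x = x \<otimes> g"
    using assms by (metis inv_solve_right' m_closed)
  finally show ?thesis using assms by (simp add: commutator_map_eq)
qed

text \<open>The displacement of \<open>x\<close> under conjugation by \<open>g\<close> is the commutator of \<open>inv x\<close> and \<open>g\<close>.\<close>

lemma (in group) inner_subset_absolute_central_iff: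
  "inner_auto G \<subseteq> absolute_central_auto G \<longleftrightarrow> derived G (carrier G) \<subseteq> absolute_centre G"
proof
  assume L: "inner_auto G \<subseteq> absolute_central_auto G"
  have "x \<otimes> g \<otimes> inv x \<otimes> inv g \<in> absolute_centre G" if xg: "x \<in> carrier G" "g \<in> carrier G" for x g
  proof -
    have "(\<lambda>x \<in> carrier G. g \<otimes> x \<otimes> inv g) \<in> absolute_central_auto G"
      using L xg by (auto simp: inner_auto_def)
    then have "inv (inv x) \<otimes> (g \<otimes> inv x \<otimes> inv g) \<in> absolute_centre G"
      using xg unfolding absolute_central_auto_def by (auto dest!: bspec[of _ _ "inv x"] simp del: inv_inv)
    then show ?thesis using xg by (simp add: m_assoc)
  qed
  then show "derived G (carrier G) \<subseteq> absolute_centre G"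
    unfolding derived_def by (intro generate_subgroup_incl subgroup_absolute_centre) blast
next
  assume der: "derived G (carrier G) \<subseteq> absolute_centre G"
  have "inv x \<otimes> (g \<otimes> x \<otimes> inv g) \<in> absolute_centre G" if xg: "x \<in> carrier G" "g \<in> carrier G" for x g
  proof -
    have "inv x \<otimes> g \<otimes> inv (inv x) \<otimes> inv g \<in> derived G (carrier G)"
      unfolding derived_def using xg inv_closed by (intro generate.incl) blast
    then show ?thesis using der xg by (auto simp: m_assoc)
  qed
  then show "inner_auto G \<subseteq> absolute_central_auto G"
    using conjugation_in_auto by (auto simp: inner_auto_def absolute_central_auto_def)
qed

lemma (in group) commutator_map_hom:
  assumes der: "derived G (carrier G) \<subseteq> absolute_centre G" and g: "g \<in> carrier G"
  shows "commutator_map G g \<in> hom G G"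
    and "\<forall>x\<in>carrier G. commutator_map G g x \<in> absolute_centre G"
proof -
  have "(\<lambda>x \<in> carrier G. g \<otimes> x \<otimes> inv g) \<in> absolute_central_auto G"
    using der g inner_subset_absolute_central_iff by (auto simp: inner_auto_def)
  then show "commutator_map G g \<in> hom G G" "\<forall>x\<in>carrier G. commutator_map G g x \<in> absolute_centre G"
    unfolding commutator_map_def by (rule displacement_hom)+
qed

text \<open>When commutators lie in \<open>L(G)\<close>, they are central, and the pairing is skew-symmetric; this turns a
  homomorphism in the second argument into one in the first.\<close>

lemma (in group) commutator_map_swap:
  assumes der: "derived G (carrier G) \<subseteq> absolute_centre G" and gx: "g \<in> carrier G" "x \<in> carrier G"
  shows "commutator_map G x g = inv (commutator_map G g x)"
proof -
  define z where "z = commutator_map G g x"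
  have z: "z \<in> absolute_centre G" using commutator_map_hom[OF der gx(1)] gx by (simp add: z_def)
  then have zC: "z \<in> carrier G" by (simp add: absolute_centre_def)
  have "x \<otimes> g \<otimes> z = x \<otimes> z \<otimes> g" using absolute_centre_commutes[OF z gx(1)] gx zC by (simp add: m_assoc)
  also have "\<dots> = g \<otimes> x"
    using gx by (simp add: z_def commutator_map_eq m_assoc) (simp flip: m_assoc)
  finally have xgz: "x \<otimes> g \<otimes> z = g \<otimes> x" .
  have "commutator_map G x g \<otimes> z = inv g \<otimes> (x \<otimes> g \<otimes> z) \<otimes> inv x"
    using absolute_centre_commutes[OF z, of "inv x"] gx zC by (simp add: commutator_map_eq m_assoc)
  also have "\<dots> = \<one>" unfolding xgz using gx by (simp add: m_assoc) 
  finally show ?thesis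
    using inv_equality[of "commutator_map G x g" z] zC gx by (simp add: z_def commutator_map_eq)
qed

text \<open>Two elements that induce the same inner automorphism differ by a central element, so
  \<open>|Inn(G)| \<ge> |G/Z(G)|\<close>.\<close>

lemma (in group) order_le_card_inner:
  assumes fin: "finite (carrier G)"
  shows "order G \<le> card (inner_auto G) * card (centre G)"
proof -
  define conj where "conj g = (\<lambda>x \<in> carrier G. g \<otimes> x \<otimes> inv g)" for g
  have finZ: "finite (centre G)" using fin by (simp add: centre_def)
  have "card (carrier G) \<le> card (centre G) * card (conj ` carrier G)"
  proof (rule card_le_fibre_bound[OF fin])
    fix y assume "y \<in> conj ` carrier G"
    then obtain g where g: "g \<in> carrier G" "y = conj g" by blast
    have "inv g \<otimes> h \<in> centre G" if h: "h \<in> carrier G" "conj h = conj g" for h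
    proof -
      have "(inv g \<otimes> h) \<otimes> x = x \<otimes> (inv g \<otimes> h)" if x: "x \<in> carrier G" for x
      proof -
        have "h \<otimes> x \<otimes> inv h = g \<otimes> x \<otimes> inv g" using fun_cong[OF h(2), of x] x by (simp add: conj_def)
        moreover have "h \<otimes> x = (h \<otimes> x \<otimes> inv h) \<otimes> h" using h(1) x by (simp add: m_assoc)
        ultimately have "h \<otimes> x = g \<otimes> x \<otimes> inv g \<otimes> h" by simp
        then have "inv g \<otimes> (h \<otimes> x) = inv g \<otimes> (g \<otimes> (x \<otimes> inv g \<otimes> h))"
          using g h(1) x by (simp add: m_assoc)
        also have "\<dots> = x \<otimes> inv g \<otimes> h" using g h(1) x by (simp flip: m_assoc)
        finally show ?thesis using g h(1) x by (simp add: m_assoc)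
      qed
      then show ?thesis using g h by (simp add: centre_def)
    qed
    then have "(\<lambda>h. inv g \<otimes> h) ` {h \<in> carrier G. conj h = y} \<subseteq> centre G" using g by auto
    moreover have "inj_on (\<lambda>h. inv g \<otimes> h) {h \<in> carrier G. conj h = y}"
      using g by (auto simp: inj_on_def)
    ultimately show "card {h \<in> carrier G. conj h = y} \<le> card (centre G)"
      using finZ by (intro card_inj_on_le)
  qed
  moreover have "conj ` carrier G = inner_auto G" by (simp add: inner_auto_def conj_def)
  ultimately show ?thesis by (simp add: order_def mult.commute)
qed

section \<open>The criterion\<close>

text \<open>The form in which the equality of the two groups of automorphisms is exploited: every element of
  \<open>Hom(G/L(G), L(G))\<close> comes from a commutator.\<close>

lemma (in group) hom_is_commutator_map:
  assumes fin: "finite (carrier G)" and eq: "absolute_central_auto G = inner_auto G"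
    and f: "f \<in> hom G G" "\<forall>x\<in>carrier G. f x \<in> absolute_centre G"
      "\<forall>x\<in>absolute_centre G. f x = \<one>"
  obtains g where "g \<in> carrier G" "\<forall>x\<in>carrier G. f x = commutator_map G g x"
proof -
  have "(\<lambda>x \<in> carrier G. x \<otimes> f x) \<in> inner_auto G"
    using absolute_central_auto_of_hom[OF fin f] eq by simp
  then obtain g where g: "g \<in> carrier G"
    and fg: "(\<lambda>x \<in> carrier G. x \<otimes> f x) = (\<lambda>x \<in> carrier G. g \<otimes> x \<otimes> inv g)"
    by (auto simp: inner_auto_def)
  have "f x = commutator_map G g x" if x: "x \<in> carrier G" for x
  proof -
    have fx: "f x \<in> carrier G" using f(1) x by (auto simp: hom_def)
    have "x \<otimes> f x = g \<otimes> x \<otimes> inv g" using fun_cong[OF fg, of x] x by simp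
    then have "commutator_map G g x = inv x \<otimes> (x \<otimes> f x)" using x by (simp add: commutator_map_eq)
    then show ?thesis using x fx by (simp flip: m_assoc)
  qed
  then show ?thesis using that g by blast
qed

text \<open>Displacements kill \<open>L(G)\<close> and, having values in a group of exponent dividing \<open>N\<close>, also all
  \<open>N\<close>-th powers. So they kill \<open>Z(G)\<close>, and as \<open>L(G)\<close> is cyclic there are at most \<open>|G/Z(G)|\<close> of them.
  But the inner automorphisms already provide that many.\<close>

lemma (in group) absolute_central_auto_eq_inner_if:
  assumes fin: "finite (carrier G)"
    and exp: "\<forall>x\<in>absolute_centre G. x [^] (N::nat) = \<one>"
    and der: "derived G (carrier G) \<subseteq> absolute_centre G"
    and cyc: "cyclic_group (G\<lparr>carrier := absolute_centre G\<rparr>)"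
    and Z: "centre G = absolute_centre G <#> power_subgroup G N"
  shows "absolute_central_auto G = inner_auto G"
proof -
  obtain c where c: "c \<in> absolute_centre G" "generate G {c} = absolute_centre G"
    using cyc cyclic_subgroup_iff[OF subgroup_absolute_centre] by blast
  have cC: "c \<in> carrier G" using c by (simp add: absolute_centre_def)
  define F where "F = displacement G ` absolute_central_auto G"
  have F: "f \<in> hom G G" "\<forall>x\<in>carrier G. f x \<in> absolute_centre G" "\<forall>x\<in>absolute_centre G. f x = \<one>"
    if "f \<in> F" for f
    using that displacement_hom by (auto simp: F_def)
  have kill: "f z = \<one>" if fF: "f \<in> F" and z: "z \<in> centre G" for f z
  proof -
    interpret f: group_hom G G f by unfold_locales (rule F(1)[OF fF])
    have "f (x [^] N) = \<one>" if "x \<in> carrier G" for x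
      using that exp F(2)[OF fF] by (simp add: f.hom_nat_pow)
    then have "(\<lambda>x. x [^] N) ` carrier G \<subseteq> kernel G G f" by (auto simp: kernel_def)
    then have P: "power_subgroup G N \<subseteq> kernel G G f"
      unfolding power_subgroup_def by (intro generate_subgroup_incl f.subgroup_kernel)
    obtain l q where lq: "l \<in> absolute_centre G" "q \<in> power_subgroup G N" "z = l \<otimes> q"
      using z Z by (auto simp: set_mult_def)
    have "f l = \<one>" "l \<in> carrier G" using F(3)[OF fF] lq(1) by (auto simp: absolute_centre_def)
    moreover have "f q = \<one>" "q \<in> carrier G" using P lq(2) by (auto simp: kernel_def)
    ultimately show ?thesis using lq(3) by simp
  qed
  have "card F * card (centre G) \<le> order G"
  proof (rule card_homs_to_cyclic_le[OF fin cC subgroup_centre])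
    show "F \<subseteq> hom G G" using F(1) by blast
    show "f x \<in> generate G {c}" if "f \<in> F" "x \<in> carrier G" for f x
      using F(2) that c(2) by blast
    show "F \<subseteq> extensional (carrier G)" by (auto simp: F_def displacement_def)
  qed (rule kill)
  also have "\<dots> \<le> card (inner_auto G) * card (centre G)" by (rule order_le_card_inner[OF fin])
  finally have "card F * card (centre G) \<le> card (inner_auto G) * card (centre G)" .
  moreover have "card (centre G) > 0"
  proof -
    have "finite (centre G)" using fin by (simp add: centre_def)
    then show ?thesis using subgroup.one_closed[OF subgroup_centre] by (auto simp: card_gt_0_iff)
  qed
  ultimately have "card F \<le> card (inner_auto G)" by simp
  then have card: "card (absolute_central_auto G) \<le> card (inner_auto G)"
    using card_image[OF inj_on_displacement] by (simp add: F_def)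
  have "absolute_central_auto G \<subseteq> PiE (carrier G) (\<lambda>_. carrier G)"
    by (auto simp: absolute_central_auto_def auto_def Bij_def hom_def PiE_def)
  then have "finite (absolute_central_auto G)"
    by (rule finite_subset) (intro finite_PiE fin)
  then have "inner_auto G = absolute_central_auto G"
    using der inner_subset_absolute_central_iff card by (intro card_seteq) auto
  then show ?thesis by simp
qed

text \<open>The commutator of \<open>g\<close> with \<open>x^N\<close> is the \<open>N\<close>-th power of that with \<open>x\<close>, an
  element of \<open>L(G)\<close>.\<close>

lemma (in group) pow_in_centre:
  assumes exp: "\<forall>x\<in>absolute_centre G. x [^] (N::nat) = \<one>"
    and der: "derived G (carrier G) \<subseteq> absolute_centre G" and x: "x \<in> carrier G"
  shows "x [^] N \<in> centre G"
proof -
  have "g \<otimes> x [^] N = x [^] N \<otimes> g" if g: "g \<in> carrier G" for g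
  proof -
    interpret b: group_hom G G "commutator_map G g"
      by unfold_locales (rule commutator_map_hom(1)[OF der g])
    have "commutator_map G g (x [^] N) = \<one>"
      using exp commutator_map_hom(2)[OF der g] x by (simp add: b.hom_nat_pow)
    then show ?thesis using commutator_map_eq_one_iff g x by simp
  qed
  then show ?thesis using x by (simp add: centre_def)
qed

text \<open>If a central \<open>z\<close> lay outside \<open>L(G) G^N\<close>, some homomorphism into \<open>L(G)\<close> killing \<open>L(G)\<close> would be
  nontrivial at \<open>z\<close>. But that homomorphism is a commutator map, which vanishes at central elements.\<close>

lemma (in group) centre_eq_if_absolute_central_auto_eq_inner:
  assumes p: "Factorial_Ring.prime p" and ordG: "order G = p ^ e"
    and eq: "absolute_central_auto G = inner_auto G"
    and c: "c \<in> absolute_centre G" and exp: "\<forall>x\<in>absolute_centre G. x [^] ord c = \<one>"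
  shows "centre G = absolute_centre G <#> power_subgroup G (ord c)"
proof
  let ?L = "absolute_centre G" and ?P = "power_subgroup G (ord c)"
  have fin: "finite (carrier G)"
    using ordG prime_gt_0_nat[OF p] order_gt_0_iff_finite by simp
  have cC: "c \<in> carrier G" using c by (simp add: absolute_centre_def)
  have der: "derived G (carrier G) \<subseteq> ?L" using inner_subset_absolute_central_iff eq by blast
  have L: "?L \<lhd> G" by (rule normal_if_contains_derived[OF subgroup_absolute_centre der])
  have P: "subgroup ?P G" unfolding power_subgroup_def by (intro generate_is_subgroup) auto
  interpret S: second_isomorphism_grp ?L G ?P
    by (intro second_isomorphism_grp.intro second_isomorphism_grp_axioms.intro L P)
  have "?P \<subseteq> centre G"
    unfolding power_subgroup_def
    using pow_in_centre[OF exp der] by (intro generate_subgroup_incl subgroup_centre) blast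
  then show "?L <#> ?P \<subseteq> centre G"
    using absolute_centre_subset_centre subgroup.m_closed[OF subgroup_centre]
    by (auto simp: set_mult_def)
  show "centre G \<subseteq> ?L <#> ?P"
  proof (rule subsetI, rule ccontr)
    fix z assume z: "z \<in> centre G" and notin: "z \<notin> ?L <#> ?P"
    have zC: "z \<in> carrier G" using z by (simp add: centre_def)
    have pow: "x [^] ord c \<in> ?L <#> ?P" if "x \<in> carrier G" for x
      using that S.S_contained_in_set_mult unfolding power_subgroup_def by (blast intro: generate.incl)
    have derK: "derived G (carrier G) \<subseteq> ?L <#> ?P" using der S.H_contained_in_set_mult by blast
    from homs_to_cyclic_separate[OF p ordG S.normal_set_mult_subgroup derK cC pow zC notin]
    obtain f where f: "f \<in> hom G G" "\<forall>x\<in>carrier G. f x \<in> generate G {c}"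
      "\<forall>k\<in>?L <#> ?P. f k = \<one>" "f z \<noteq> \<one>" .
    have "generate G {c} \<subseteq> ?L" using c by (intro generate_subgroup_incl subgroup_absolute_centre) auto
    then have into: "\<forall>x\<in>carrier G. f x \<in> ?L" using f(2) by blast
    have kill: "\<forall>x\<in>?L. f x = \<one>" using f(3) S.H_contained_in_set_mult by blast
    from hom_is_commutator_map[OF fin eq f(1) into kill]
    obtain g where "g \<in> carrier G" "\<forall>x\<in>carrier G. f x = commutator_map G g x" .
    then have "f z = \<one>" using commutator_map_eq_one_iff z zC by (simp add: centre_def)
    then show False using f(4) by simp
  qed
qed

text \<open>If \<open>L(G)\<close> is not cyclic, it contains \<open>c\<close> and \<open>d\<close> of order \<open>p\<close> with \<open>d \<notin> \<langle>c\<rangle>\<close>. Choose a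
  subgroup \<open>M \<supseteq> Z(G)\<close> and an \<open>x\<close> whose image generates the nontrivial cyclic group \<open>G/M\<close>. The
  homomorphisms that kill \<open>M\<close> and send \<open>x\<close> to \<open>c\<close> and to \<open>d\<close> are the commutator maps of some \<open>g\<close> and
  \<open>h\<close>, and \<open>g\<close> is not central. Hence some homomorphism \<open>f\<close> with values in a cyclic subgroup
  \<open>\<langle>u\<rangle>\<close> of \<open>L(G)\<close> kills \<open>Z(G)\<close> but not \<open>g\<close>, and \<open>f\<close> is the commutator map of some
  \<open>w = k x^i\<close> with \<open>k \<in> M\<close>. By skew-symmetry, \<open>f(g)\<close> and \<open>f(h)\<close> are the inverses of \<open>c^i\<close>
  and \<open>d^i\<close>. As \<open>f(g)\<close> is nontrivial, \<open>i\<close> is prime to \<open>p\<close>, so both \<open>c\<close> and \<open>d\<close> lie in \<open>\<langle>u\<rangle>\<close>,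
  which has only \<open>p\<close> solutions of \<open>y^p = 1\<close>: a contradiction.\<close>

lemma (in group) cyclic_absolute_centre_if_eq_inner:
  assumes p: "Factorial_Ring.prime p" and ordG: "order G = p ^ e"
    and nonab: "centre G \<noteq> carrier G"
    and eq: "absolute_central_auto G = inner_auto G"
    and u: "u \<in> absolute_centre G" and exp: "\<forall>x\<in>absolute_centre G. x [^] ord u = \<one>"
  shows "cyclic_group (G\<lparr>carrier := absolute_centre G\<rparr>)"
proof (rule ccontr)
  let ?L = "absolute_centre G"
  assume noncyc: "\<not> cyclic_group (G\<lparr>carrier := ?L\<rparr>)"
  note subL = subgroup_absolute_centre
  have LC: "?L \<subseteq> carrier G" by (rule subgroup.subset[OF subL])
  have fin: "finite (carrier G)"
    using ordG prime_gt_0_nat[OF p] order_gt_0_iff_finite by simp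
  have p1: "p > 1" by (rule prime_gt_1_nat[OF p])
  have der: "derived G (carrier G) \<subseteq> ?L" using inner_subset_absolute_central_iff eq by blast
  have derZ: "derived G (carrier G) \<subseteq> centre G" using der absolute_centre_subset_centre by blast
  define S where "S = {x \<in> ?L. x [^] p = \<one>}"
  \<comment> \<open>cyclic subgroups do not have room for both \<open>c\<close> and \<open>d\<close> chosen below\<close>
  have few_if_cyclic: "card {y \<in> generate G {v}. y [^] p = \<one>} \<le> p" if "v \<in> carrier G" for v
    using card_roots_cyclic_le[OF fin that] p1 by simp
  have "p < card S"
  proof (rule ccontr)
    assume "\<not> p < card S"
    interpret L: comm_group "G\<lparr>carrier := ?L\<rparr>"
      using subgroup.subgroup_is_group[OF subL is_group] absolute_centre_commutes LC
      by (intro group.group_comm_groupI) auto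
    have "card ?L dvd p ^ e" using lagrange[OF subL] ordG by (metis dvd_triv_right)
    then obtain e' where "order (G\<lparr>carrier := ?L\<rparr>) = p ^ e'"
      using p divides_primepow_nat by (auto simp: order_def)
    moreover have "card {x \<in> carrier (G\<lparr>carrier := ?L\<rparr>).
        x [^]\<^bsub>G\<lparr>carrier := ?L\<rparr>\<^esub> p = \<one>\<^bsub>G\<lparr>carrier := ?L\<rparr>\<^esub>} \<le> p"
      using \<open>\<not> p < card S\<close> by (simp add: S_def flip: nat_pow_consistent)
    ultimately obtain x where x: "x \<in> ?L" "generate (G\<lparr>carrier := ?L\<rparr>) {x} = ?L"
      using L.p_group_cyclic_if_few_roots[OF p] by (metis partial_object.select_convs(1) partial_object.update_convs(1) partial_object.surjective)
    then have "generate G {x} = ?L" using generate_consistent[of "{x}" ?L] subL by simp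
    then show False using noncyc cyclic_subgroup_iff[OF subL] x by blast
  qed
  have finS: "finite S" using fin LC by (auto simp: S_def intro: finite_subset)
  have "\<not> S \<subseteq> {\<one>}" using \<open>p < card S\<close> p1 card_mono[of "{\<one>}" S] by auto
  then obtain c where c: "c \<in> ?L" "c [^] p = \<one>" "c \<noteq> \<one>" by (auto simp: S_def)
  have cC: "c \<in> carrier G" using c LC by blast
  have "card (generate G {c}) = p"
    using ord_eq_prime[OF p cC c(2,3)] cC by (simp flip: generate_pow_card)
  moreover have fingc: "finite (generate G {c})"
    using fin cC generate_incl[of "{c}"] finite_subset by blast
  ultimately have "\<not> S \<subseteq> generate G {c}" using \<open>p < card S\<close> card_mono[of "generate G {c}" S] by auto
  then obtain d where d: "d \<in> ?L" "d [^] p = \<one>" "d \<notin> generate G {c}" by (auto simp: S_def)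
  have dC: "d \<in> carrier G" using d LC by blast
  have d1: "d \<noteq> \<one>" using d(3) generate.one by auto
  obtain a where a: "a \<in> carrier G" "a \<notin> centre G"
    using nonab by (auto simp: centre_def)
  from cyclic_quotient_avoiding[OF p ordG subgroup_centre derZ a]
  obtain M x j where M: "subgroup M G" "centre G \<subseteq> M" "a \<notin> M" and x: "x \<in> carrier G"
    and gen: "\<forall>g\<in>carrier G. \<exists>k\<in>M. \<exists>i::nat. g = k \<otimes> x [^] i"
    and pow_iff: "\<forall>i::nat. x [^] i \<in> M \<longleftrightarrow> p ^ Suc j dvd i" .
  have derM: "derived G (carrier G) \<subseteq> M" using derZ M(2) by blast
  have commutators: "\<exists>g\<in>carrier G. \<forall>k\<in>M. \<forall>i::nat. commutator_map G g (k \<otimes> x [^] i) = b [^] i"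
    if b: "b \<in> ?L" "b [^] p = \<one>" for b
  proof -
    have bC: "b \<in> carrier G" using b LC by blast
    have "\<forall>i::nat. x [^] i \<in> M \<longrightarrow> b [^] i = \<one>"
    proof (intro allI impI)
      fix i :: nat assume "x [^] i \<in> M"
      then have "p dvd i" using pow_iff by (metis dvd_mult_left power_Suc)
      then show "b [^] i = \<one>" using b(2) bC by (metis dvd_trans pow_eq_id)
    qed
    from hom_on_cyclic_quotient[OF M(1) derM x gen bC this]
    obtain f where f: "f \<in> hom G G" "\<forall>k\<in>M. \<forall>i::nat. f (k \<otimes> x [^] i) = b [^] i" .
    have into: "\<forall>y\<in>carrier G. f y \<in> ?L"
    proof
      fix y assume "y \<in> carrier G"
      then obtain k i where "k \<in> M" "y = k \<otimes> x [^] (i::nat)" using gen by blast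
      then have "f y = b [^] i" using f(2) by simp
      also have "\<dots> \<in> ?L"
        using b(1) subgroup.one_closed[OF subL] subgroup.m_closed[OF subL] by (induction i) auto
      finally show "f y \<in> ?L" .
    qed
    have kill: "\<forall>y\<in>?L. f y = \<one>"
    proof
      fix y assume y: "y \<in> ?L"
      then have "y \<in> M" using absolute_centre_subset_centre M(2) by blast
      then have "f (y \<otimes> x [^] (0::nat)) = b [^] (0::nat)" using f(2) by blast
      then show "f y = \<one>" using y LC by auto
    qed
    from hom_is_commutator_map[OF fin eq f(1) into kill]
    obtain g where "g \<in> carrier G" "\<forall>y\<in>carrier G. f y = commutator_map G g y" .
    moreover have "k \<otimes> x [^] i \<in> carrier G" if "k \<in> M" for k and i :: nat
      using that subgroup.mem_carrier[OF M(1)] x by simp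
    ultimately show ?thesis using f(2) by metis
  qed
  obtain g where g: "g \<in> carrier G"
    and bg: "\<forall>k\<in>M. \<forall>i::nat. commutator_map G g (k \<otimes> x [^] i) = c [^] i"
    using commutators[OF c(1,2)] by blast
  obtain h where h: "h \<in> carrier G"
    and bh: "\<forall>k\<in>M. \<forall>i::nat. commutator_map G h (k \<otimes> x [^] i) = d [^] i"
    using commutators[OF d(1,2)] by blast
  have "commutator_map G g (\<one> \<otimes> x [^] (1::nat)) = c [^] (1::nat)"
    using bg subgroup.one_closed[OF M(1)] by blast
  then have "commutator_map G g x \<noteq> \<one>" using x c cC by simp
  then have gZ: "g \<notin> centre G" using commutator_map_eq_one_iff[OF g x] x by (auto simp: centre_def)
  have uC: "u \<in> carrier G" using u LC by blast
  from homs_to_cyclic_separate[OF p ordG subgroup_centre derZ uC pow_in_centre[OF exp der] g gZ]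
  obtain f where f: "f \<in> hom G G" "\<forall>x\<in>carrier G. f x \<in> generate G {u}"
    "\<forall>k\<in>centre G. f k = \<one>" "f g \<noteq> \<one>" .
  have "generate G {u} \<subseteq> ?L" using u by (intro generate_subgroup_incl subL) auto
  then have into: "\<forall>x\<in>carrier G. f x \<in> ?L" using f(2) by blast
  have kill: "\<forall>x\<in>?L. f x = \<one>" using f(3) absolute_centre_subset_centre by blast
  from hom_is_commutator_map[OF fin eq f(1) into kill]
  obtain w where w: "w \<in> carrier G" "\<forall>y\<in>carrier G. f y = commutator_map G w y" .
  obtain k i where ki: "k \<in> M" "w = k \<otimes> x [^] (i::nat)" using gen w(1) by blast
  have fg: "f g = inv (c [^] i)" and fh: "f h = inv (d [^] i)"
    using commutator_map_swap[OF der _ w(1)] w(2) g h bg bh ki by auto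
  have subU: "subgroup (generate G {u}) G" using uC by (simp add: generate_is_subgroup)
  have "inv (f g) \<in> generate G {u}" "inv (f h) \<in> generate G {u}"
    using f(2) g h subgroup.m_inv_closed[OF subU] by auto
  then have inU: "c [^] i \<in> generate G {u}" "d [^] i \<in> generate G {u}"
    using fg fh cC dC by auto
  have ci: "c [^] i \<noteq> \<one>" using f(4) fg by auto
  have "ord c = ord d" using ord_eq_prime[OF p] cC c dC d d1 by metis
  \<comment> \<open>\<open>c\<close> and \<open>d\<close> have the same order, so \<open>i\<close> is a multiple of both orders or of neither\<close>
  then have di: "d [^] i \<noteq> \<one>" using ci cC dC by (simp add: pow_eq_id)
  have in_root: "y \<in> generate G {u}"
    if y: "y \<in> carrier G" "y [^] p = \<one>" "y [^] i \<in> generate G {u}" "y [^] i \<noteq> \<one>" for y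
  proof -
    have "y [^] i \<in> generate G {y}" using generate_singleton_nat[OF fin y(1)] by blast
    then have "generate G {y [^] i} = generate G {y}"
      by (rule generate_eq_if_prime_order(2)[OF fin p y(1,2) _ y(4)])
    then have "y \<in> generate G {y [^] i}" by (simp add: generate.incl)
    also have "\<dots> \<subseteq> generate G {u}" using y(3) by (intro generate_subgroup_incl subU) auto
    finally show ?thesis .
  qed
  have cu: "c \<in> generate G {u}" and du: "d \<in> generate G {u}"
    using in_root[OF cC c(2) inU(1) ci] in_root[OF dC d(2) inU(2) di] .
  let ?R = "{y \<in> generate G {u}. y [^] p = \<one>}"
  have "generate G {c} \<subseteq> generate G {u}" using cu by (intro generate_subgroup_incl subU) auto
  moreover have "y [^] p = \<one>" if "y \<in> generate G {c}" for y
    using generate_eq_if_prime_order(1)[OF fin p cC c(2) that] by (cases "y = \<one>") auto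
  ultimately have "insert d (generate G {c}) \<subseteq> ?R" using du d(2) by blast
  moreover have "finite ?R" using fin uC generate_incl[of "{u}"] by (auto intro: finite_subset)
  ultimately have "card (insert d (generate G {c})) \<le> card ?R" by (intro card_mono)
  also have "\<dots> \<le> p" by (rule few_if_cyclic[OF uC])
  finally show False
    using fingc d(3) \<open>card (generate G {c}) = p\<close> by simp
qed

theorem theorem3p4:
  fixes G :: "('a, 'b) monoid_scheme" (structure) and p n :: nat
  assumes "Factorial_Ring.prime p"
    and "finite_p_group p G"
    and "\<not> comm_group G"
    and "p ^ n = group_exponent (G\<lparr>carrier := absolute_centre G\<rparr>)"
  shows "absolute_central_auto G = inner_auto G \<longleftrightarrow>
    derived G (carrier G) \<subseteq> absolute_centre G \<and>
    cyclic_group (G\<lparr>carrier := absolute_centre G\<rparr>) \<and>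
    centre G = absolute_centre G <#> power_subgroup G (p ^ n)"
proof -
  let ?L = "absolute_centre G"
  interpret group G using assms(2) by (simp add: finite_p_group_def)
  obtain e where ordG: "order G = p ^ e" using assms(2) by (auto simp: finite_p_group_def)
  have fin: "finite (carrier G)" using assms(2) by (simp add: finite_p_group_def)
  note subL = subgroup_absolute_centre
  interpret L: group "G\<lparr>carrier := ?L\<rparr>" by (rule subgroup.subgroup_is_group[OF subL is_group])
  have "card ?L dvd p ^ e" using lagrange[OF subL] ordG by (metis dvd_triv_right)
  then obtain e' where ordL: "order (G\<lparr>carrier := ?L\<rparr>) = p ^ e'"
    using assms(1) divides_primepow_nat by (auto simp: order_def)
  from L.p_group_exponent_attained[OF assms(1) ordL]
  obtain u where u: "u \<in> ?L" "L.ord u = p ^ n" and "\<forall>x\<in>?L. x [^]\<^bsub>G\<lparr>carrier := ?L\<rparr>\<^esub> (p ^ n) = \<one>"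
    unfolding assms(4)[symmetric] by auto
  then have exp: "\<forall>x\<in>?L. x [^] (p ^ n) = \<one>" by (simp flip: nat_pow_consistent)
  have uC: "u \<in> carrier G" using u subgroup.mem_carrier[OF subL] by blast
  have "u [^] m = \<one> \<longleftrightarrow> p ^ n dvd m" for m :: nat
  proof -
    have "u [^]\<^bsub>G\<lparr>carrier := ?L\<rparr>\<^esub> m = \<one>\<^bsub>G\<lparr>carrier := ?L\<rparr>\<^esub> \<longleftrightarrow> L.ord u dvd m"
      by (rule L.pow_eq_id) (simp add: u(1))
    then show ?thesis unfolding u(2) nat_pow_consistent[of u m ?L] by simp
  qed
  then have ordu: "ord u = p ^ n" using ord_unique[OF uC] by blast
  have nonab: "centre G \<noteq> carrier G"
  proof
    assume "centre G = carrier G"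
    then have "comm_group G" by (intro group_comm_groupI) (auto simp: centre_def)
    then show False using assms(3) by simp
  qed
  show ?thesis
  proof
    assume eq: "absolute_central_auto G = inner_auto G"
    show "derived G (carrier G) \<subseteq> ?L \<and> cyclic_group (G\<lparr>carrier := ?L\<rparr>) \<and>
        centre G = ?L <#> power_subgroup G (p ^ n)"
      using inner_subset_absolute_central_iff eq
        cyclic_absolute_centre_if_eq_inner[OF assms(1) ordG nonab eq u(1)]
        centre_eq_if_absolute_central_auto_eq_inner[OF assms(1) ordG eq u(1)] exp ordu by simp
  qed (use absolute_central_auto_eq_inner_if[OF fin exp] in blast)
qed

end
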